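(* For seed and target states with Schmidt rank $\geq 3$, the optimal local-operations (LO) strategy may be better than the optimal local-unitary (LU) strategy; that is, it can happen for a target $|\psi\rangle$ and a seed $|\phi\rangle$ of Schmidt rank $\geq 3$ that $F_{\mathrm{LO}}(|\psi\rangle,|\phi\rangle)>F_{\mathrm{LU}}(|\psi\rangle,|\phi\rangle)$.
   Context: All states are bipartite pure states in finite dimension; the Schmidt rank is the number of nonzero Schmidt coefficients. Fidelity: $F(R,S)=\|\sqrt R\sqrt S\|_1^2$; for a pure argument, $F(|\psi\rangle\langle\psi|,\sigma)=\langle\psi|\sigma|\psi\rangle$. First argument = target, second = seed. $F_{\mathrm{LU}}(|\psi\rangle,|\phi\rangle)=\max_{U,V}|\langle\psi|(U\otimes V)|\phi\rangle|^2$ over local unitaries $U,V$, where both states are first embedded by local isometries into common local spaces. $F_{\mathrm{LO}}(|\psi\rangle,|\phi\rangle)=\max_{\mathcal E,\mathcal F}\langle\psi|(\mathcal E\otimes\mathcal F)(|\phi\rangle\langle\phi|)|\psi\rangle$ over quantum channels $\mathcal E,\mathcal F$ from the seed's local spaces to the target's local spaces. *)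

theory Defs
  imports "Jordan_Normal_Form.Schur_Decomposition"
begin

text \<open>
  Finite-dimensional Hilbert spaces are \<open>carrier_vec d\<close> over the complex numbers. The product basis
  vector \<open>i, k\<close> of a bipartite space with local dimensions \<open>dA\<close>, \<open>dB\<close> has index \<open>i * dB + k\<close>.
  In \<open>v \<bullet>c w\<close> it is the second argument that is conjugated, so the bracket
  of a bra \<open>w\<close> with a ket \<open>v\<close> is \<open>v \<bullet>c w\<close>.
\<close>

definition tensor_vec :: "complex vec \<Rightarrow> complex vec \<Rightarrow> complex vec" where
  "tensor_vec v w = vec (dim_vec v * dim_vec w)
     (\<lambda>k. v $ (k div dim_vec w) * w $ (k mod dim_vec w))"

definition tensor_mat :: "complex mat \<Rightarrow> complex mat \<Rightarrow> complex mat" where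
  "tensor_mat A B = mat (dim_row A * dim_row B) (dim_col A * dim_col B)
     (\<lambda>(r, s). A $$ (r div dim_row B, s div dim_col B) * B $$ (r mod dim_row B, s mod dim_col B))"

definition bipartite_state :: "nat \<Rightarrow> nat \<Rightarrow> complex vec \<Rightarrow> bool" where
  "bipartite_state dA dB \<psi> \<longleftrightarrow> \<psi> \<in> carrier_vec (dA * dB) \<and> \<psi> \<bullet>c \<psi> = 1"

definition pure_density :: "complex vec \<Rightarrow> complex mat" where
  "pure_density \<psi> = mat (dim_vec \<psi>) (dim_vec \<psi>) (\<lambda>(i, j). \<psi> $ i * cnj (\<psi> $ j))"

definition pure_fidelity :: "complex vec \<Rightarrow> complex mat \<Rightarrow> real" where
  "pure_fidelity \<psi> \<sigma> = Re ((\<sigma> *\<^sub>v \<psi>) \<bullet>c \<psi>)"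

definition orthonormal :: "nat \<Rightarrow> complex vec list \<Rightarrow> bool" where
  "orthonormal d es \<longleftrightarrow> set es \<subseteq> carrier_vec d \<and>
     (\<forall>i<length es. \<forall>j<length es. es ! i \<bullet>c es ! j = (if i = j then 1 else 0))"

definition schmidt_decomposition ::
    "nat \<Rightarrow> nat \<Rightarrow> complex vec \<Rightarrow> real list \<Rightarrow> complex vec list \<Rightarrow> complex vec list \<Rightarrow> bool" where
  "schmidt_decomposition dA dB \<psi> cs es fs \<longleftrightarrow>
     length es = length cs \<and> length fs = length cs \<and>
     orthonormal dA es \<and> orthonormal dB fs \<and> (\<forall>c\<in>set cs. 0 \<le> c) \<and>
     \<psi> = vec (dA * dB) (\<lambda>k. \<Sum>i<length cs. of_real (cs ! i) * tensor_vec (es ! i) (fs ! i) $ k)"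

text \<open>
  A Schmidt decomposition always exists, and its nonzero coefficients are determined by the vector
  up to order (they are the nonzero singular values of its coefficient matrix), so the description
  below is well defined.
\<close>

definition schmidt_rank :: "nat \<Rightarrow> nat \<Rightarrow> complex vec \<Rightarrow> nat" where
  "schmidt_rank dA dB \<psi> =
     (THE r. \<exists>cs es fs. schmidt_decomposition dA dB \<psi> cs es fs \<and>
        r = length (filter (\<lambda>c. c \<noteq> 0) cs))"

definition isometry_mat :: "nat \<Rightarrow> nat \<Rightarrow> complex mat \<Rightarrow> bool" where
  "isometry_mat m n J \<longleftrightarrow> J \<in> carrier_mat n m \<and> mat_adjoint J * J = 1\<^sub>m m"

definition unitary_mat :: "nat \<Rightarrow> complex mat \<Rightarrow> bool" where
  "unitary_mat n U \<longleftrightarrow>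
     U \<in> carrier_mat n n \<and> mat_adjoint U * U = 1\<^sub>m n \<and> U * mat_adjoint U = 1\<^sub>m n"

text \<open>
  In the order on complex numbers used here, \<open>0 \<le> z\<close> means that \<open>z\<close> is real and nonnegative; over
  the complex numbers the condition below therefore forces \<open>A\<close> to be Hermitian.
\<close>

definition psd_mat :: "nat \<Rightarrow> complex mat \<Rightarrow> bool" where
  "psd_mat n A \<longleftrightarrow> A \<in> carrier_mat n n \<and> (\<forall>v\<in>carrier_vec n. 0 \<le> (A *\<^sub>v v) \<bullet>c v)"

definition mat_trace :: "complex mat \<Rightarrow> complex" where
  "mat_trace A = (\<Sum>i<dim_row A. A $$ (i, i))"

definition matrix_unit :: "nat \<Rightarrow> nat \<Rightarrow> nat \<Rightarrow> complex mat" where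
  "matrix_unit n i j = mat n n (\<lambda>(r, s). if r = i \<and> s = j then 1 else 0)"

text \<open>
  For linear maps \<open>\<E>\<close> (from \<open>a \<times> a\<close> to \<open>a' \<times> a'\<close> matrices) and \<open>\<F>\<close> (from \<open>b \<times> b\<close> to \<open>b' \<times> b'\<close>
  matrices), this is the linear map with \<open>A \<otimes> B \<mapsto> \<E> A \<otimes> \<F> B\<close>, obtained by expanding the argument
  in products of matrix units.
\<close>

definition tensor_map ::
    "nat \<Rightarrow> nat \<Rightarrow> nat \<Rightarrow> nat \<Rightarrow> (complex mat \<Rightarrow> complex mat) \<Rightarrow> (complex mat \<Rightarrow> complex mat)
      \<Rightarrow> complex mat \<Rightarrow> complex mat" where
  "tensor_map a a' b b' \<E> \<F> X = mat (a' * b') (a' * b')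
     (\<lambda>(r, s). \<Sum>i<a. \<Sum>j<a. \<Sum>k<b. \<Sum>l<b. X $$ (i * b + k, j * b + l) *
        tensor_mat (\<E> (matrix_unit a i j)) (\<F> (matrix_unit b k l)) $$ (r, s))"

definition linear_mat_map :: "nat \<Rightarrow> nat \<Rightarrow> (complex mat \<Rightarrow> complex mat) \<Rightarrow> bool" where
  "linear_mat_map m n \<E> \<longleftrightarrow>
     (\<forall>X\<in>carrier_mat m m. \<E> X \<in> carrier_mat n n) \<and>
     (\<forall>X\<in>carrier_mat m m. \<forall>Y\<in>carrier_mat m m. \<E> (X + Y) = \<E> X + \<E> Y) \<and>
     (\<forall>c. \<forall>X\<in>carrier_mat m m. \<E> (c \<cdot>\<^sub>m X) = c \<cdot>\<^sub>m \<E> X)"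

definition completely_positive :: "nat \<Rightarrow> nat \<Rightarrow> (complex mat \<Rightarrow> complex mat) \<Rightarrow> bool" where
  "completely_positive m n \<E> \<longleftrightarrow>
     (\<forall>k X. psd_mat (k * m) X \<longrightarrow> psd_mat (k * n) (tensor_map k k m n id \<E> X))"

definition quantum_channel :: "nat \<Rightarrow> nat \<Rightarrow> (complex mat \<Rightarrow> complex mat) \<Rightarrow> bool" where
  "quantum_channel m n \<E> \<longleftrightarrow>
     linear_mat_map m n \<E> \<and> completely_positive m n \<E> \<and>
     (\<forall>X\<in>carrier_mat m m. mat_trace (\<E> X) = mat_trace X)"

text \<open>
  In both optimal fidelities the target \<open>\<psi>\<close>, with local dimensions \<open>tA\<close>, \<open>tB\<close>, comes first and the
  seed \<open>\<phi>\<close>, with local dimensions \<open>sA\<close>, \<open>sB\<close>, comes second. Both suprema are over subsets of \<open>[0, 1]\<close>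
  and are attained. The maximum over local unitaries does not depend on the embeddings into common
  local spaces (of dimensions \<open>nA\<close>, \<open>nB\<close>), so \<open>F_LU\<close> ranges over all embeddings.
\<close>

definition F_LU :: "nat \<Rightarrow> nat \<Rightarrow> complex vec \<Rightarrow> nat \<Rightarrow> nat \<Rightarrow> complex vec \<Rightarrow> real" where
  "F_LU tA tB \<psi> sA sB \<phi> = Sup
     {(cmod ((tensor_mat U V *\<^sub>v (tensor_mat KA KB *\<^sub>v \<phi>)) \<bullet>c (tensor_mat JA JB *\<^sub>v \<psi>)))\<^sup>2
       | nA nB JA JB KA KB U V.
           isometry_mat tA nA JA \<and> isometry_mat tB nB JB \<and>
           isometry_mat sA nA KA \<and> isometry_mat sB nB KB \<and>
           unitary_mat nA U \<and> unitary_mat nB V}"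

definition F_LO :: "nat \<Rightarrow> nat \<Rightarrow> complex vec \<Rightarrow> nat \<Rightarrow> nat \<Rightarrow> complex vec \<Rightarrow> real" where
  "F_LO tA tB \<psi> sA sB \<phi> = Sup
     {pure_fidelity \<psi> (tensor_map sA tA sB tB \<E> \<F> (pure_density \<phi>))
       | \<E> \<F>. quantum_channel sA tA \<E> \<and> quantum_channel sB tB \<F>}"

end

theory Submission
  imports Defs
begin

text \<open>
  Take the maximally entangled states of local dimension \<open>m\<close> as target and \<open>m n\<close> as seed, with
  \<open>n > 1\<close>. Discarding a tensor factor of dimension \<open>n\<close> on both sides turns the seed into the target,
  so local operations reach fidelity 1. Under local unitaries, every product vector has overlap at
  most \<open>1 / \<surd>(m n)\<close> with the seed, by Bessel's inequality, and the target is a sum of \<open>m\<close> product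
  vectors of norm \<open>1 / \<surd>m\<close>; hence the fidelity is at most \<open>m / (m n) = 1 / n\<close>.
\<close>

section \<open>Index arithmetic and coordinates of tensor products\<close>

lemma mult_add_less:
  assumes "p < a" "q < b"
  shows "p * b + q < a * (b::nat)"
proof -
  have "p * b + q < Suc p * b" using assms(2) by simp
  also have "\<dots> \<le> a * b" using assms(1) by (intro mult_le_mono1) simp
  finally show ?thesis .
qed

text \<open>A product basis vector has index \<open>i * b + j\<close>, so a sum over the product
  basis splits into one sum per tensor factor. The coordinate computations below rest on
  this.\<close>

lemma sum_lessThan_mult:
  fixes f :: "nat \<Rightarrow> 'a::comm_monoid_add"
  shows "(\<Sum>k<a * b. f k) = (\<Sum>i<a. \<Sum>j<b. f (i * b + j))"
proof -
  have "(\<Sum>k<a * b. f k) = (\<Sum>i<a. sum f {i * b..<i * b + b})"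
    by (simp add: sum.nat_group)
  also have "\<dots> = (\<Sum>i<a. \<Sum>j<b. f (i * b + j))"
  proof (rule sum.cong[OF refl])
    fix i
    show "sum f {i * b..<i * b + b} = (\<Sum>j<b. f (i * b + j))"
      using sum.shift_bounds_nat_ivl[of f 0 "i * b" b]
      by (simp add: add.commute lessThan_atLeast0)
  qed
  finally show ?thesis .
qed

lemma cscalar_prod_sum:
  assumes "w \<in> carrier_vec N"
  shows "v \<bullet>c w = (\<Sum>x<N. v $ x * cnj (w $ x))"
  using assms by (simp add: scalar_prod_def lessThan_atLeast0)

lemma mult_mat_vec_index_sum:
  assumes "A \<in> carrier_mat M N" "v \<in> carrier_vec N" "r < M"
  shows "(A *\<^sub>v v) $ r = (\<Sum>s<N. A $$ (r, s) * v $ s)"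
  using assms by (simp add: scalar_prod_def lessThan_atLeast0)

lemma quadratic_form_sum:
  assumes "A \<in> carrier_mat N N" "v \<in> carrier_vec N"
  shows "(A *\<^sub>v v) \<bullet>c v = (\<Sum>r<N. \<Sum>s<N. A $$ (r, s) * v $ s * cnj (v $ r))"
  using assms
  by (simp add: cscalar_prod_sum[OF assms(2)] mult_mat_vec_index_sum[OF assms] sum_distrib_right
      del: index_mult_mat_vec)

lemma tensor_mat_index:
  assumes "A \<in> carrier_mat a a'" "B \<in> carrier_mat b b'" "p < a" "p' < a'" "q < b" "q' < b'"
  shows "tensor_mat A B $$ (p * b + q, p' * b' + q') = A $$ (p, p') * B $$ (q, q')"
  using assms mult_add_less[of p a q b] mult_add_less[of p' a' q' b']
  by (simp add: tensor_mat_def)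

lemma tensor_mat_carrier:
  "A \<in> carrier_mat a a' \<Longrightarrow> B \<in> carrier_mat b b' \<Longrightarrow> tensor_mat A B \<in> carrier_mat (a * b) (a' * b')"
  by (auto simp: tensor_mat_def)

lemma tensor_mult_vec_index:
  assumes "A \<in> carrier_mat a a'" "B \<in> carrier_mat b b'" "v \<in> carrier_vec (a' * b')" "p < a" "q < b"
  shows "(tensor_mat A B *\<^sub>v v) $ (p * b + q) =
    (\<Sum>i<a'. \<Sum>j<b'. A $$ (p, i) * B $$ (q, j) * v $ (i * b' + j))"
  using mult_add_less[OF assms(4,5)]
  by (simp add: mult_mat_vec_index_sum[OF tensor_mat_carrier[OF assms(1,2)] assms(3)]
      sum_lessThan_mult tensor_mat_index[OF assms(1,2,4) _ assms(5)] del: index_mult_mat_vec)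

lemma tensor_map_carrier: "tensor_map a a' b b' \<E> \<F> X \<in> carrier_mat (a' * b') (a' * b')"
  by (simp add: tensor_map_def)

lemma matrix_unit_carrier [simp]: "matrix_unit n i j \<in> carrier_mat n n"
  by (simp add: matrix_unit_def)

lemma matrix_unit_index [simp]:
  "r < n \<Longrightarrow> s < n \<Longrightarrow> matrix_unit n i j $$ (r, s) = (if r = i \<and> s = j then 1 else 0)"
  by (simp add: matrix_unit_def)

lemma tensor_map_index:
  assumes "\<And>X. X \<in> carrier_mat a a \<Longrightarrow> \<E> X \<in> carrier_mat a' a'"
    and "\<And>X. X \<in> carrier_mat b b \<Longrightarrow> \<F> X \<in> carrier_mat b' b'"
    and "p < a'" "q < a'" "p' < b'" "q' < b'"
  shows "tensor_map a a' b b' \<E> \<F> X $$ (p * b' + p', q * b' + q') =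
    (\<Sum>i<a. \<Sum>j<a. \<Sum>k<b. \<Sum>l<b. X $$ (i * b + k, j * b + l) *
        (\<E> (matrix_unit a i j) $$ (p, q) * \<F> (matrix_unit b k l) $$ (p', q')))"
  using mult_add_less[OF assms(3,5)] mult_add_less[OF assms(4,6)]
  by (simp add: tensor_map_def tensor_mat_index[OF assms(1,2) assms(3-6)])

text \<open>The identity on the first factor fixes the block indices \<open>p\<close> and
  \<open>q\<close>, so \<open>\<E>\<close> acts on each block of \<open>X\<close> separately.
  Complete positivity is handled through this formula.\<close>

lemma tensor_map_id_index:
  assumes E: "\<And>X. X \<in> carrier_mat m m \<Longrightarrow> \<E> X \<in> carrier_mat n n"
    and less: "p < k" "q < k" "r < n" "s < n"
  shows "tensor_map k k m n id \<E> X $$ (p * n + r, q * n + s) =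
    (\<Sum>u<m. \<Sum>v<m. X $$ (p * m + u, q * m + v) * \<E> (matrix_unit m u v) $$ (r, s))"
proof -
  let ?g = "\<lambda>i j. \<Sum>u<m. \<Sum>v<m. X $$ (i * m + u, j * m + v) * \<E> (matrix_unit m u v) $$ (r, s)"
  have "tensor_map k k m n id \<E> X $$ (p * n + r, q * n + s) =
    (\<Sum>i<k. \<Sum>j<k. if j = q then (if i = p then ?g i j else 0) else 0)"
    by (subst tensor_map_index[where \<E> = id, OF _ E less], simp, assumption,
        rule sum.cong[OF refl], rule sum.cong[OF refl]) (use less in auto)
  also have "\<dots> = ?g p q"
    using less by simp
  finally show ?thesis .
qed

section \<open>Maximally entangled states\<close>

definition max_entangled :: "nat \<Rightarrow> complex vec" where
  "max_entangled d = vec (d * d) (\<lambda>k. if k div d = k mod d then of_real (1 / sqrt d) else 0)"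

lemma max_entangled_carrier [simp]: "max_entangled d \<in> carrier_vec (d * d)"
  by (simp add: max_entangled_def)

lemma max_entangled_index:
  "i < d \<Longrightarrow> j < d \<Longrightarrow> max_entangled d $ (i * d + j) = (if i = j then of_real (1 / sqrt d) else 0)"
  using mult_add_less[of i d j d] by (simp add: max_entangled_def)

lemma inverse_sqrt_square: "complex_of_real (1 / sqrt d) * complex_of_real (1 / sqrt d) = 1 / of_nat d"
proof -
  have "complex_of_real (1 / sqrt d) * complex_of_real (1 / sqrt d) = of_real (1 / sqrt d * (1 / sqrt d))"
    by (simp only: of_real_mult)
  also have "1 / sqrt d * (1 / sqrt d) = 1 / real d"
    by (simp add: field_simps)
  finally show ?thesis by simp
qed

lemma bipartite_state_max_entangled:
  assumes "d > 0"
  shows "bipartite_state d d (max_entangled d)"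
proof -
  have "max_entangled d \<bullet>c max_entangled d =
    (\<Sum>i<d. \<Sum>j<d. if j = i then of_real (1 / sqrt d) * of_real (1 / sqrt d) else 0)"
    unfolding cscalar_prod_sum[OF max_entangled_carrier] sum_lessThan_mult
    by (rule sum.cong[OF refl], rule sum.cong[OF refl]) (simp add: max_entangled_index)
  also have "\<dots> = (\<Sum>i<d. 1 / of_nat d)"
    unfolding inverse_sqrt_square by simp
  also have "\<dots> = 1" using assms by simp
  finally show ?thesis by (simp add: bipartite_state_def)
qed

subsection \<open>Schmidt rank\<close>

lemma tensor_vec_index:
  assumes "v \<in> carrier_vec a" "w \<in> carrier_vec b" "i < a" "j < b"
  shows "tensor_vec v w $ (i * b + j) = v $ i * w $ j"
  using assms mult_add_less[OF assms(3,4)] by (simp add: tensor_vec_def)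

lemma orthonormal_nth_carrier: "orthonormal d es \<Longrightarrow> i < length es \<Longrightarrow> es ! i \<in> carrier_vec d"
  by (auto simp: orthonormal_def)

lemma orthonormal_sum:
  assumes "orthonormal d es" "i < length es" "j < length es"
  shows "(\<Sum>x<d. es ! i $ x * cnj (es ! j $ x)) = (if i = j then 1 else 0)"
  using assms cscalar_prod_sum[OF orthonormal_nth_carrier[OF assms(1,3)], of "es ! i"]
  by (simp add: orthonormal_def)

text \<open>The coefficient matrix of the state is \<open>1 / sqrt d\<close> times the identity, so
  all its singular values are \<open>1 / sqrt d\<close>. This holds for an arbitrary decomposition,
  which gives the uniqueness that the description in \<open>schmidt_rank\<close> needs.\<close>

lemma schmidt_max_entangled_length:
  assumes d: "d > 0" and dec: "schmidt_decomposition d d (max_entangled d) cs es fs"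
  shows "length cs = d" and "\<forall>c\<in>set cs. c \<noteq> 0"
proof -
  define s where "s = complex_of_real (1 / sqrt d)"
  define L where "L = length cs"
  have ss: "s * s = 1 / of_nat d" unfolding s_def by (rule inverse_sqrt_square)
  have s0: "s \<noteq> 0" and cs': "cnj s = s" using d by (auto simp: s_def)
  have len: "length es = L" "length fs = L" and oe: "orthonormal d es" and of: "orthonormal d fs"
    and nn: "\<forall>c\<in>set cs. 0 \<le> c"
    and eq: "max_entangled d =
      vec (d * d) (\<lambda>k. \<Sum>i<L. of_real (cs ! i) * tensor_vec (es ! i) (fs ! i) $ k)"
    using dec by (auto simp: schmidt_decomposition_def L_def)
  \<comment> \<open>The decomposition as a matrix identity: the scalar matrix \<open>s\<close>
    equals the sum of the rank one matrices built from \<open>es ! i\<close> and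
    \<open>fs ! i\<close>.\<close>
  have M: "(if a = b then s else 0) = (\<Sum>i<L. of_real (cs ! i) * (es ! i $ a * fs ! i $ b))"
    if "a < d" "b < d" for a b
  proof -
    have "(if a = b then s else 0) = max_entangled d $ (a * d + b)"
      using that by (simp add: max_entangled_index s_def)
    also have "\<dots> = (\<Sum>i<L. of_real (cs ! i) * (es ! i $ a * fs ! i $ b))"
      unfolding eq using mult_add_less[OF that]
      by (auto simp: tensor_vec_index[OF orthonormal_nth_carrier[OF oe]
            orthonormal_nth_carrier[OF of] that] len intro!: sum.cong)
    finally show ?thesis .
  qed
  \<comment> \<open>Row \<open>a\<close> of \<open>M\<close> is paired with \<open>fs ! j\<close>;
    orthonormality of \<open>fs\<close> leaves only the term \<open>i = j\<close>.\<close>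
  have fe: "s * cnj (fs ! j $ a) = of_real (cs ! j) * es ! j $ a" if "j < L" "a < d" for j a
  proof -
    have "s * cnj (fs ! j $ a) = (\<Sum>b<d. (if a = b then s else 0) * cnj (fs ! j $ b))"
      using that by (simp add: if_distrib[of "\<lambda>x. x * _"] cong: if_cong)
    also have "\<dots> = (\<Sum>b<d. \<Sum>i<L. of_real (cs ! i) * es ! i $ a * (fs ! i $ b * cnj (fs ! j $ b)))"
      using that by (intro sum.cong refl) (simp add: M sum_distrib_right sum_distrib_left mult_ac)
    also have "\<dots> = (\<Sum>i<L. of_real (cs ! i) * es ! i $ a * (\<Sum>b<d. fs ! i $ b * cnj (fs ! j $ b)))"
      by (subst sum.swap) (simp add: sum_distrib_left)
    also have "\<dots> = (\<Sum>i<L. if i = j then of_real (cs ! i) * es ! i $ a else 0)"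
      using that by (intro sum.cong) (auto simp: orthonormal_sum[OF of] len)
    also have "\<dots> = of_real (cs ! j) * es ! j $ a"
      using that by simp
    finally show ?thesis .
  qed
  \<comment> \<open>The vectors on the two sides of \<open>fe\<close> have equal norms, and
    \<open>es ! j\<close> and \<open>fs ! j\<close> are unit vectors.\<close>
  have c2: "of_real (cs ! j) * of_real (cs ! j) = 1 / (of_nat d :: complex)" if "j < L" for j
  proof -
    have "1 / of_nat d = s * s * (\<Sum>x<d. fs ! j $ x * cnj (fs ! j $ x))"
      using that by (simp add: orthonormal_sum[OF of] len ss)
    also have "\<dots> = (\<Sum>x<d. (s * cnj (fs ! j $ x)) * cnj (s * cnj (fs ! j $ x)))"
      by (simp add: sum_distrib_left cs' mult_ac)
    also have "\<dots> = (\<Sum>x<d. of_real (cs ! j) * of_real (cs ! j) * (es ! j $ x * cnj (es ! j $ x)))"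
      using that by (intro sum.cong refl) (simp add: fe mult_ac del: complex_cnj_mult, simp add: mult_ac)
    also have "\<dots> = of_real (cs ! j) * of_real (cs ! j)"
      using that by (simp add: orthonormal_sum[OF oe] len flip: sum_distrib_left)
    finally show ?thesis by simp
  qed
  show "\<forall>c\<in>set cs. c \<noteq> 0"
    using c2 d by (fastforce simp: in_set_conv_nth L_def)
  \<comment> \<open>The number \<open>L\<close> of terms comes from the trace of the coefficient
    matrix, multiplied by \<open>s\<close> so that \<open>fe\<close> can replace \<open>fs\<close>
    by \<open>es\<close>: the left side is 1 and the right side becomes \<open>L / d\<close>. The
    trivial test \<open>a = a\<close> gives the summand the shape of a diagonal entry in
    \<open>M\<close>.\<close>
  have "s * (of_nat d * s) = s * (\<Sum>a<d. if a = a then s else 0)"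
    by simp
  also have "\<dots> = s * (\<Sum>a<d. \<Sum>i<L. of_real (cs ! i) * (es ! i $ a * fs ! i $ a))"
    by (rule arg_cong[where f="\<lambda>x. s * x"], rule sum.cong[OF refl], rule M) auto
  also have "\<dots> = (\<Sum>i<L. \<Sum>a<d. of_real (cs ! i) * (es ! i $ a * cnj (s * cnj (fs ! i $ a))))"
    by (subst sum.swap) (simp add: sum_distrib_left cs' mult_ac)
  also have "\<dots> = (\<Sum>i<L. \<Sum>a<d. of_real (cs ! i) * of_real (cs ! i) * (es ! i $ a * cnj (es ! i $ a)))"
    by (intro sum.cong refl) (simp add: fe mult_ac del: complex_cnj_mult, simp add: mult_ac)
  also have "\<dots> = (\<Sum>i<L. 1 / of_nat d)"
    unfolding sum_distrib_left[symmetric]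
    by (intro sum.cong refl) (simp add: orthonormal_sum[OF oe] len c2)
  finally have "of_nat d * (s * s) = of_nat L / of_nat d" by (simp add: mult_ac)
  then have "(of_nat d :: complex) = of_nat L" using d by (simp add: ss)
  then show "length cs = d" unfolding L_def of_nat_eq_iff by simp
qed

lemma schmidt_decomposition_max_entangled:
  "schmidt_decomposition d d (max_entangled d)
     (replicate d (1 / sqrt d)) (map (unit_vec d) [0..<d]) (map (unit_vec d) [0..<d])"
proof -
  have "unit_vec d i \<bullet>c unit_vec d j = (if i = j then 1 else (0::complex))" if "i < d" "j < d" for i j
  proof -
    have "unit_vec d i \<bullet>c unit_vec d j = (\<Sum>x<d. if x = j then if i = j then 1 else 0 else (0::complex))"
      unfolding cscalar_prod_sum[OF unit_vec_carrier]
      by (rule sum.cong[OF refl]) (use that in auto)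
    also have "\<dots> = (if i = j then 1 else 0)"
      using that by simp
    finally show ?thesis .
  qed
  then have on: "orthonormal d (map (unit_vec d) [0..<d])"
    by (auto simp: orthonormal_def)
  have "max_entangled d = vec (d * d) (\<lambda>k. \<Sum>i<d.
      of_real (1 / sqrt d) * tensor_vec (unit_vec d i) (unit_vec d i) $ k)" (is "_ = ?v")
  proof
    fix k assume "k < dim_vec ?v"
    then have k: "k < d * d" by simp
    then have "d > 0" by (cases d) auto
    then have less: "k div d < d" "k mod d < d"
      using k by (auto simp: less_mult_imp_div_less)
    have "?v $ k = (\<Sum>i<d. if i = k mod d then if k div d = k mod d then of_real (1 / sqrt d) else 0 else 0)"
      unfolding index_vec[OF k] by (rule sum.cong[OF refl]) (use k less in \<open>auto simp: tensor_vec_def\<close>)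
    also have "\<dots> = max_entangled d $ k"
      using k less by (simp add: max_entangled_def)
    finally show "max_entangled d $ k = ?v $ k" by simp
  qed (simp add: max_entangled_def)
  with on show ?thesis
    by (auto simp: schmidt_decomposition_def)
qed

text \<open>The standard basis decomposition gives existence; uniqueness holds because every
  decomposition has exactly \<open>d\<close> coefficients, all nonzero.\<close>

lemma schmidt_rank_max_entangled:
  assumes "d > 0"
  shows "schmidt_rank d d (max_entangled d) = d"
  unfolding schmidt_rank_def
proof (rule the_equality)
  have "length (filter (\<lambda>c. c \<noteq> 0) (replicate d (1 / sqrt d))) = d"
    using assms by simp
  then show "\<exists>cs es fs. schmidt_decomposition d d (max_entangled d) cs es fs \<and>
      d = length (filter (\<lambda>c. c \<noteq> 0) cs)"
    using schmidt_decomposition_max_entangled[of d] by (intro exI conjI) (assumption, simp)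
next
  fix r
  assume "\<exists>cs es fs. schmidt_decomposition d d (max_entangled d) cs es fs \<and>
      r = length (filter (\<lambda>c. c \<noteq> 0) cs)"
  then show "r = d"
    using schmidt_max_entangled_length[OF assms] by auto
qed

subsection \<open>Local unitaries\<close>

lemma mat_adjoint_mult_index:
  assumes "A \<in> carrier_mat n m" "i < m" "j < m"
  shows "(mat_adjoint A * A) $$ (i, j) = (\<Sum>x<n. A $$ (x, j) * cnj (A $$ (x, i)))"
  using assms by (auto simp: mat_adjoint_def scalar_prod_def lessThan_atLeast0 mult.commute intro!: sum.cong)

text \<open>An isometry is a matrix with orthonormal columns. This entrywise form is the one that
  Bessel's inequality takes.\<close>

lemma isometry_mat_iff:
  "isometry_mat m n J \<longleftrightarrow> J \<in> carrier_mat n m \<and>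
     (\<forall>i<m. \<forall>j<m. (\<Sum>x<n. J $$ (x, i) * cnj (J $$ (x, j))) = (if i = j then 1 else 0))"
proof (cases "J \<in> carrier_mat n m")
  case True
  \<comment> \<open>The entry is read at \<open>(j, i)\<close> because
    \<open>mat_adjoint_mult_index\<close> puts the conjugate on the factor that carries the row
    index.\<close>
  have "mat_adjoint J * J = 1\<^sub>m m \<longleftrightarrow>
      (\<forall>i<m. \<forall>j<m. (mat_adjoint J * J) $$ (j, i) = (if i = j then 1 else 0))"
    using True by (auto simp: mat_eq_iff mat_adjoint_def)
  then show ?thesis
    using True by (simp add: isometry_mat_def mat_adjoint_mult_index)
qed (simp add: isometry_mat_def)

lemma isometry_mat_mult:
  assumes J: "isometry_mat m n J" and U: "isometry_mat n l U"
  shows "isometry_mat m l (U * J)"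
  unfolding isometry_mat_iff
proof (intro conjI allI impI)
  have cJ: "J \<in> carrier_mat n m" and cU: "U \<in> carrier_mat l n"
    using J U by (auto simp: isometry_mat_def)
  then show "U * J \<in> carrier_mat l m" by simp
  fix i j assume ij: "i < m" "j < m"
  have "(\<Sum>x<l. (U * J) $$ (x, i) * cnj ((U * J) $$ (x, j))) =
      (\<Sum>x<l. (\<Sum>y<n. U $$ (x, y) * J $$ (y, i)) * cnj (\<Sum>z<n. U $$ (x, z) * J $$ (z, j)))"
    using cJ cU ij by (simp add: scalar_prod_def lessThan_atLeast0)
  also have "\<dots> = (\<Sum>x<l. \<Sum>y<n. \<Sum>z<n. J $$ (y, i) * cnj (J $$ (z, j)) * (U $$ (x, y) * cnj (U $$ (x, z))))"
    by (simp add: sum_product mult_ac)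
  also have "\<dots> = (\<Sum>y<n. \<Sum>z<n. \<Sum>x<l. J $$ (y, i) * cnj (J $$ (z, j)) * (U $$ (x, y) * cnj (U $$ (x, z))))"
    by (subst sum.swap, rule sum.cong[OF refl], rule sum.swap)
  also have "\<dots> = (\<Sum>y<n. \<Sum>z<n. if y = z then J $$ (y, i) * cnj (J $$ (z, j)) else 0)"
    unfolding sum_distrib_left[symmetric]
    by (rule sum.cong[OF refl], rule sum.cong[OF refl]) (use U in \<open>auto simp: isometry_mat_iff\<close>)
  also have "\<dots> = (if i = j then 1 else 0)"
    using J ij by (simp add: isometry_mat_iff)
  finally show "(\<Sum>x<l. (U * J) $$ (x, i) * cnj ((U * J) $$ (x, j))) = (if i = j then 1 else 0)" .
qed

text \<open>With \<open>b\<close> the orthogonal projection of \<open>a\<close> onto the span of the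
  vectors \<open>p _ j\<close>, the squared norm of \<open>a - b\<close> is the right side minus the
  left side, and it is nonnegative.\<close>

lemma bessel_inequality:
  fixes p :: "nat \<Rightarrow> nat \<Rightarrow> complex"
  assumes orth: "\<And>j k. j < D \<Longrightarrow> k < D \<Longrightarrow> (\<Sum>x<N. p x j * cnj (p x k)) = (if j = k then 1 else 0)"
  shows "(\<Sum>j<D. (cmod (\<Sum>x<N. p x j * cnj (a x)))\<^sup>2) \<le> (\<Sum>x<N. (cmod (a x))\<^sup>2)"
proof -
  define g where "g j = (\<Sum>x<N. p x j * cnj (a x))" for j
  define b where "b x = (\<Sum>j<D. p x j * cnj (g j))" for x
  have ab: "(\<Sum>x<N. b x * cnj (a x)) = (\<Sum>j<D. g j * cnj (g j))"
  proof -
    have "(\<Sum>x<N. b x * cnj (a x)) = (\<Sum>x<N. \<Sum>j<D. cnj (g j) * (p x j * cnj (a x)))"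
      by (simp add: b_def sum_distrib_left sum_distrib_right mult_ac)
    also have "\<dots> = (\<Sum>j<D. cnj (g j) * g j)"
      by (subst sum.swap) (simp add: g_def sum_distrib_left)
    finally show ?thesis by (simp add: mult.commute)
  qed
  have "(\<Sum>x<N. b x * cnj (b x)) =
      (\<Sum>x<N. \<Sum>j<D. \<Sum>k<D. cnj (g j) * g k * (p x j * cnj (p x k)))"
    unfolding b_def cnj_sum sum_product by (intro sum.cong refl) (simp add: mult_ac)
  also have "\<dots> = (\<Sum>j<D. \<Sum>k<D. \<Sum>x<N. cnj (g j) * g k * (p x j * cnj (p x k)))"
    by (subst sum.swap, rule sum.cong[OF refl], rule sum.swap)
  also have "\<dots> = (\<Sum>j<D. \<Sum>k<D. if j = k then cnj (g j) * g k else 0)"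
    unfolding sum_distrib_left[symmetric]
    by (rule sum.cong[OF refl], rule sum.cong[OF refl]) (simp add: orth)
  finally have bb: "(\<Sum>x<N. b x * cnj (b x)) = (\<Sum>j<D. g j * cnj (g j))"
    by (simp add: mult.commute)
  \<comment> \<open>The right side of \<open>ab\<close> is real, so conjugation gives the other
    mixed term the same value.\<close>
  have "cnj (\<Sum>x<N. b x * cnj (a x)) = cnj (\<Sum>j<D. g j * cnj (g j))"
    by (simp only: ab)
  then have ba: "(\<Sum>x<N. a x * cnj (b x)) = (\<Sum>j<D. g j * cnj (g j))"
    by (simp add: mult.commute)
  have "complex_of_real (\<Sum>x<N. (cmod (a x - b x))\<^sup>2) =
      (\<Sum>x<N. a x * cnj (a x) - b x * cnj (a x) - a x * cnj (b x) + b x * cnj (b x))"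
    by (simp only: of_real_sum complex_norm_square) (simp add: algebra_simps)
  also have "\<dots> = (\<Sum>x<N. a x * cnj (a x)) - (\<Sum>j<D. g j * cnj (g j))"
    by (simp add: sum.distrib sum_subtractf ab ba bb)
  also have "\<dots> = complex_of_real ((\<Sum>x<N. (cmod (a x))\<^sup>2) - (\<Sum>j<D. (cmod (g j))\<^sup>2))"
    by (simp only: of_real_sum of_real_diff complex_norm_square)
  finally have "(\<Sum>x<N. (cmod (a x - b x))\<^sup>2) = (\<Sum>x<N. (cmod (a x))\<^sup>2) - (\<Sum>j<D. (cmod (g j))\<^sup>2)"
    by (simp only: of_real_eq_iff)
  moreover have "0 \<le> (\<Sum>x<N. (cmod (a x - b x))\<^sup>2)"
    by (simp add: sum_nonneg)
  ultimately show ?thesis by (simp add: g_def)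
qed

lemma isometry_mat_bessel:
  assumes P: "isometry_mat D N P" and A: "isometry_mat m N A" and i: "i < m"
  shows "(\<Sum>j<D. (cmod (\<Sum>x<N. P $$ (x, j) * cnj (A $$ (x, i))))\<^sup>2) \<le> 1"
proof -
  have "(\<Sum>j<D. (cmod (\<Sum>x<N. P $$ (x, j) * cnj (A $$ (x, i))))\<^sup>2) \<le> (\<Sum>x<N. (cmod (A $$ (x, i)))\<^sup>2)"
    using P by (intro bessel_inequality) (simp add: isometry_mat_iff)
  moreover have "complex_of_real (\<Sum>x<N. (cmod (A $$ (x, i)))\<^sup>2) = of_real 1"
    unfolding of_real_sum complex_norm_square using A i by (simp add: isometry_mat_iff)
  ultimately show ?thesis unfolding of_real_eq_iff by simp
qed

lemma tensor_mult_max_entangled_index: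
  assumes "A \<in> carrier_mat a D" "B \<in> carrier_mat b D" "p < a" "q < b"
  shows "(tensor_mat A B *\<^sub>v max_entangled D) $ (p * b + q) =
    of_real (1 / sqrt D) * (\<Sum>i<D. A $$ (p, i) * B $$ (q, i))"
proof -
  have "(tensor_mat A B *\<^sub>v max_entangled D) $ (p * b + q) =
      (\<Sum>i<D. \<Sum>j<D. if i = j then of_real (1 / sqrt D) * (A $$ (p, i) * B $$ (q, j)) else 0)"
    unfolding tensor_mult_vec_index[OF assms(1,2) max_entangled_carrier assms(3,4)]
    by (rule sum.cong[OF refl], rule sum.cong[OF refl]) (simp add: max_entangled_index)
  also have "\<dots> = (\<Sum>i<D. of_real (1 / sqrt D) * (A $$ (p, i) * B $$ (q, i)))"
    by simp
  finally show ?thesis by (simp only: sum_distrib_left)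
qed

text \<open>A local unitary after a local embedding acts on the seed like the single isometry
  \<open>U * A\<close> on one side and \<open>V * B\<close> on the other.\<close>

lemma tensor_mult_tensor_mult_max_entangled_index:
  assumes U: "U \<in> carrier_mat c a" and V: "V \<in> carrier_mat d b"
    and A: "A \<in> carrier_mat a D" and B: "B \<in> carrier_mat b D" and less: "p < c" "q < d"
  shows "(tensor_mat U V *\<^sub>v (tensor_mat A B *\<^sub>v max_entangled D)) $ (p * d + q) =
    of_real (1 / sqrt D) * (\<Sum>i<D. (U * A) $$ (p, i) * (V * B) $$ (q, i))"
proof -
  let ?s = "complex_of_real (1 / sqrt D)"
  have "(tensor_mat U V *\<^sub>v (tensor_mat A B *\<^sub>v max_entangled D)) $ (p * d + q) =
      (\<Sum>x<a. \<Sum>y<b. U $$ (p, x) * V $$ (q, y) * (?s * (\<Sum>i<D. A $$ (x, i) * B $$ (y, i))))"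
    by (subst tensor_mult_vec_index[OF U V _ less])
      (use tensor_mat_carrier[OF A B] in \<open>auto simp: tensor_mult_max_entangled_index[OF A B]
         simp del: index_mult_mat_vec intro!: sum.cong\<close>)
  also have "\<dots> = (\<Sum>x<a. \<Sum>y<b. \<Sum>i<D. ?s * ((U $$ (p, x) * A $$ (x, i)) * (V $$ (q, y) * B $$ (y, i))))"
    by (simp only: sum_distrib_left mult_ac)
  also have "\<dots> = (\<Sum>x<a. \<Sum>i<D. \<Sum>y<b. ?s * ((U $$ (p, x) * A $$ (x, i)) * (V $$ (q, y) * B $$ (y, i))))"
    by (rule sum.cong[OF refl], rule sum.swap)
  also have "\<dots> = (\<Sum>i<D. \<Sum>x<a. \<Sum>y<b. ?s * ((U $$ (p, x) * A $$ (x, i)) * (V $$ (q, y) * B $$ (y, i))))"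
    by (rule sum.swap)
  also have "\<dots> = (\<Sum>i<D. ?s * ((\<Sum>x<a. U $$ (p, x) * A $$ (x, i)) * (\<Sum>y<b. V $$ (q, y) * B $$ (y, i))))"
    by (simp only: sum_product) (simp only: sum_distrib_left)
  also have "\<dots> = (\<Sum>i<D. ?s * ((U * A) $$ (p, i) * (V * B) $$ (q, i)))"
    using U V A B less by (simp add: scalar_prod_def lessThan_atLeast0)
  finally show ?thesis by (simp only: sum_distrib_left)
qed

text \<open>Up to the factor \<open>1 / sqrt (D * m)\<close>, the overlap is the sum of
  \<open>G i j * H i j\<close>, where \<open>G\<close> and \<open>H\<close> hold the inner products
  of the local columns. Bessel's inequality bounds each of the \<open>m\<close> inner sums by 1, and
  squaring gives \<open>m * m / (D * m)\<close>. Both vectors enter through their coordinates, so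
  \<open>v\<close> may include local unitaries.\<close>

lemma max_entangled_overlap_le:
  fixes v w :: "complex vec"
  assumes P: "isometry_mat D a P" and Q: "isometry_mat D b Q"
    and A: "isometry_mat m a A" and B: "isometry_mat m b B"
    and w: "w \<in> carrier_vec (a * b)"
    and v_eq: "\<And>p q. p < a \<Longrightarrow> q < b \<Longrightarrow>
      v $ (p * b + q) = of_real (1 / sqrt D) * (\<Sum>j<D. P $$ (p, j) * Q $$ (q, j))"
    and w_eq: "\<And>p q. p < a \<Longrightarrow> q < b \<Longrightarrow>
      w $ (p * b + q) = of_real (1 / sqrt m) * (\<Sum>i<m. A $$ (p, i) * B $$ (q, i))"
  shows "(cmod (v \<bullet>c w))\<^sup>2 \<le> real m / real D"
proof -
  let ?s = "complex_of_real (1 / sqrt D)" and ?t = "complex_of_real (1 / sqrt m)"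
  define G where "G i j = (\<Sum>p<a. P $$ (p, j) * cnj (A $$ (p, i)))" for i j
  define H where "H i j = (\<Sum>q<b. Q $$ (q, j) * cnj (B $$ (q, i)))" for i j
  have "v \<bullet>c w = (\<Sum>p<a. \<Sum>q<b. ?s * (\<Sum>j<D. P $$ (p, j) * Q $$ (q, j)) *
      cnj (?t * (\<Sum>i<m. A $$ (p, i) * B $$ (q, i))))"
    unfolding cscalar_prod_sum[OF w] sum_lessThan_mult
    by (rule sum.cong[OF refl], rule sum.cong[OF refl]) (simp only: v_eq w_eq lessThan_iff)
  also have "\<dots> = ?s * ?t * (\<Sum>p<a. \<Sum>q<b. \<Sum>i<m. \<Sum>j<D.
      (P $$ (p, j) * cnj (A $$ (p, i))) * (Q $$ (q, j) * cnj (B $$ (q, i))))"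
    by (simp only: sum_distrib_left sum_distrib_right complex_cnj_mult complex_cnj_complex_of_real
        cnj_sum mult_ac)
  also have "(\<Sum>p<a. \<Sum>q<b. \<Sum>i<m. \<Sum>j<D.
      (P $$ (p, j) * cnj (A $$ (p, i))) * (Q $$ (q, j) * cnj (B $$ (q, i)))) = (\<Sum>i<m. \<Sum>j<D. G i j * H i j)"
  proof -
    let ?f = "\<lambda>p q i j. (P $$ (p, j) * cnj (A $$ (p, i))) * (Q $$ (q, j) * cnj (B $$ (q, i)))"
    have "(\<Sum>p<a. \<Sum>q<b. \<Sum>i<m. \<Sum>j<D. ?f p q i j) = (\<Sum>p<a. \<Sum>i<m. \<Sum>j<D. \<Sum>q<b. ?f p q i j)"
      by (rule sum.cong[OF refl], subst sum.swap, rule sum.cong[OF refl], rule sum.swap)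
    also have "\<dots> = (\<Sum>i<m. \<Sum>j<D. \<Sum>p<a. \<Sum>q<b. ?f p q i j)"
      by (subst sum.swap, rule sum.cong[OF refl], rule sum.swap)
    finally show ?thesis by (simp only: G_def H_def sum_product)
  qed
  finally have eq: "v \<bullet>c w = ?s * ?t * (\<Sum>i<m. \<Sum>j<D. G i j * H i j)" .
  \<comment> \<open>Termwise AM-GM gives the same bound as Cauchy-Schwarz here, since Bessel's
    inequality bounds the row sums of squares of both \<open>G\<close> and \<open>H\<close> by
    1.\<close>
  have amgm: "cmod (x * y) \<le> ((cmod x)\<^sup>2 + (cmod y)\<^sup>2) / 2" for x y :: complex
    using sum_squares_bound[of "cmod x" "cmod y"] by (simp add: norm_mult)
  have "cmod (\<Sum>i<m. \<Sum>j<D. G i j * H i j) \<le> (\<Sum>i<m. \<Sum>j<D. ((cmod (G i j))\<^sup>2 + (cmod (H i j))\<^sup>2) / 2)"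
    by (intro sum_norm_le amgm)
  also have "\<dots> = (\<Sum>i<m. ((\<Sum>j<D. (cmod (G i j))\<^sup>2) + (\<Sum>j<D. (cmod (H i j))\<^sup>2)) / 2)"
    unfolding sum.distrib[symmetric] sum_divide_distrib ..
  also have "\<dots> \<le> (\<Sum>i<m. (1 + 1) / 2)"
    unfolding G_def H_def
    by (intro sum_mono divide_right_mono add_mono isometry_mat_bessel[OF P A] isometry_mat_bessel[OF Q B]) auto
  finally have le: "cmod (\<Sum>i<m. \<Sum>j<D. G i j * H i j) \<le> real m" by simp
  have "(cmod (v \<bullet>c w))\<^sup>2 = (1 / real D) * (1 / real m) * (cmod (\<Sum>i<m. \<Sum>j<D. G i j * H i j))\<^sup>2"
    unfolding eq by (simp add: norm_mult norm_divide power_mult_distrib power_divide)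
  also have "\<dots> \<le> (1 / real D) * (1 / real m) * (real m)\<^sup>2"
    by (intro mult_left_mono power_mono le) auto
  also have "\<dots> = real m / real D"
    by (simp add: power2_eq_square)
  finally show ?thesis .
qed

lemma isometry_mat_embedding:
  assumes "m \<le> n"
  shows "isometry_mat m n (mat n m (\<lambda>(i, j). if i = j then 1 else 0))"
  unfolding isometry_mat_iff
proof (intro conjI allI impI)
  fix i j assume ij: "i < m" "j < m"
  let ?J = "mat n m (\<lambda>(i, j). if i = j then 1 else 0) :: complex mat"
  have "(\<Sum>x<n. ?J $$ (x, i) * cnj (?J $$ (x, j))) = (\<Sum>x<n. if x = i then if i = j then 1 else 0 else 0)"
    by (rule sum.cong[OF refl]) (use ij in auto)
  then show "(\<Sum>x<n. ?J $$ (x, i) * cnj (?J $$ (x, j))) = (if i = j then 1 else 0)"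
    using ij assms by simp
qed simp

lemma unitary_mat_one: "unitary_mat n (1\<^sub>m n)"
proof -
  have "mat_adjoint (1\<^sub>m n :: complex mat) = 1\<^sub>m n"
    by (rule eq_matI) (auto simp: mat_adjoint_def mat_of_rows_index)
  then show ?thesis by (simp add: unitary_mat_def)
qed

lemma F_LU_max_entangled_le:
  assumes "m \<le> D"
  shows "F_LU m m (max_entangled m) D D (max_entangled D) \<le> real m / real D"
  unfolding F_LU_def
proof (rule cSup_least, goal_cases)
  \<comment> \<open>The supremum bound needs a nonempty set: the target is embedded in the first
    \<open>m\<close> coordinates, which is where \<open>m \<le> D\<close> enters, and the seed and
    the unitaries are trivial.\<close>
  case 1
  then show ?case
    using isometry_mat_embedding[OF assms] isometry_mat_embedding[OF order_refl, of D] unitary_mat_one[of D]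
    by blast
next
  case (2 x)
  then obtain nA nB JA JB KA KB U V where
    x: "x = (cmod ((tensor_mat U V *\<^sub>v (tensor_mat KA KB *\<^sub>v max_entangled D)) \<bullet>c
        (tensor_mat JA JB *\<^sub>v max_entangled m)))\<^sup>2"
    and J: "isometry_mat m nA JA" "isometry_mat m nB JB"
    and K: "isometry_mat D nA KA" "isometry_mat D nB KB"
    and UV: "unitary_mat nA U" "unitary_mat nB V"
    by blast
  have UV': "isometry_mat nA nA U" "isometry_mat nB nB V"
    using UV by (auto simp: unitary_mat_def isometry_mat_def)
  have carrier: "JA \<in> carrier_mat nA m" "JB \<in> carrier_mat nB m" "KA \<in> carrier_mat nA D"
    "KB \<in> carrier_mat nB D" "U \<in> carrier_mat nA nA" "V \<in> carrier_mat nB nB"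
    using J K UV' by (auto simp: isometry_mat_def)
  \<comment> \<open>The overlap bound is applied with \<open>U * KA\<close> and
    \<open>V * KB\<close> on the seed side and with \<open>JA\<close> and \<open>JB\<close> on the
    target side.\<close>
  show ?case unfolding x
    by (rule max_entangled_overlap_le[OF isometry_mat_mult[OF K(1) UV'(1)]
          isometry_mat_mult[OF K(2) UV'(2)] J
          mult_mat_vec_carrier[OF tensor_mat_carrier[OF carrier(1,2)] max_entangled_carrier]
          tensor_mult_tensor_mult_max_entangled_index[OF carrier(5,6,3,4)]
          tensor_mult_max_entangled_index[OF carrier(1,2)]])
qed

subsection \<open>Local operations\<close>

lemma pure_density_max_entangled_index:
  assumes "i < d" "k < d" "j < d" "l < d"
  shows "pure_density (max_entangled d) $$ (i * d + k, j * d + l) =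
    (if i = k then if j = l then 1 / of_nat d else 0 else 0)"
proof -
  have "pure_density (max_entangled d) $$ (i * d + k, j * d + l) =
      max_entangled d $ (i * d + k) * cnj (max_entangled d $ (j * d + l))"
    using mult_add_less[OF assms(1,2)] mult_add_less[OF assms(3,4)]
    by (simp add: pure_density_def carrier_vecD[OF max_entangled_carrier])
  then show ?thesis
    using assms inverse_sqrt_square[of d] by (auto simp: max_entangled_index)
qed

section \<open>Positivity, and boundedness of the fidelities reached by local operations\<close>

lemma pure_density_psd:
  assumes \<psi>: "\<psi> \<in> carrier_vec N"
  shows "psd_mat N (pure_density \<psi>)"
  unfolding psd_mat_def
proof (intro conjI ballI)
  show carrier: "pure_density \<psi> \<in> carrier_mat N N"
    using \<psi> by (simp add: pure_density_def)
  fix v :: "complex vec" assume v: "v \<in> carrier_vec N"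
  \<comment> \<open>The quadratic form is the squared modulus of the inner product \<open>?z\<close>
    of \<open>v\<close> with the state.\<close>
  let ?z = "\<Sum>r<N. \<psi> $ r * cnj (v $ r)"
  have "(pure_density \<psi> *\<^sub>v v) \<bullet>c v =
      (\<Sum>r<N. \<Sum>s<N. (\<psi> $ r * cnj (v $ r)) * cnj (\<psi> $ s * cnj (v $ s)))"
    unfolding quadratic_form_sum[OF carrier v]
    by (rule sum.cong[OF refl], rule sum.cong[OF refl]) (use \<psi> in \<open>simp add: pure_density_def\<close>)
  also have "\<dots> = ?z * cnj ?z"
    by (simp only: sum_product cnj_sum)
  also have "\<dots> = of_real ((cmod ?z)\<^sup>2)"
    by (simp only: complex_norm_square)
  finally show "0 \<le> (pure_density \<psi> *\<^sub>v v) \<bullet>c v"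
    by (simp add: less_eq_complex_def)
qed

lemma psd_mat_two_index:
  assumes A: "psd_mat N A" and ij: "i < N" "j < N"
  shows "0 \<le> A $$ (i, i) * (x * cnj x) + A $$ (i, j) * (y * cnj x) +
    A $$ (j, i) * (x * cnj y) + A $$ (j, j) * (y * cnj y)"
proof -
  \<comment> \<open>The vector is \<open>x\<close> times basis vector \<open>i\<close> plus
    \<open>y\<close> times basis vector \<open>j\<close>. Adding the two conditionals, instead of
    nesting them, keeps the formula true for \<open>i = j\<close>.\<close>
  let ?v = "vec N (\<lambda>r. (if r = i then x else 0) + (if r = j then y else 0))"
  have c: "A \<in> carrier_mat N N" and v: "?v \<in> carrier_vec N"
    using A by (auto simp: psd_mat_def)
  have row: "(\<Sum>s<N. A $$ (r, s) * ?v $ s) = A $$ (r, i) * x + A $$ (r, j) * y" for r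
  proof -
    have "(\<Sum>s<N. A $$ (r, s) * ?v $ s) =
        (\<Sum>s<N. (if s = i then A $$ (r, i) * x else 0) + (if s = j then A $$ (r, j) * y else 0))"
      by (rule sum.cong[OF refl]) (auto simp: algebra_simps)
    then show ?thesis using ij by (simp add: sum.distrib)
  qed
  have "(A *\<^sub>v ?v) \<bullet>c ?v = (\<Sum>r<N. (A $$ (r, i) * x + A $$ (r, j) * y) * cnj (?v $ r))"
    unfolding quadratic_form_sum[OF c v] sum_distrib_right[symmetric] row ..
  also have "\<dots> = (\<Sum>r<N. (if r = i then (A $$ (i, i) * x + A $$ (i, j) * y) * cnj x else 0) +
      (if r = j then (A $$ (j, i) * x + A $$ (j, j) * y) * cnj y else 0))"
    by (rule sum.cong[OF refl]) (auto simp: algebra_simps)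
  also have "\<dots> = A $$ (i, i) * (x * cnj x) + A $$ (i, j) * (y * cnj x) +
      A $$ (j, i) * (x * cnj y) + A $$ (j, j) * (y * cnj y)"
    using ij by (simp add: sum.distrib algebra_simps)
  finally have eq: "(A *\<^sub>v ?v) \<bullet>c ?v = A $$ (i, i) * (x * cnj x) + A $$ (i, j) * (y * cnj x) +
      A $$ (j, i) * (x * cnj y) + A $$ (j, j) * (y * cnj y)" .
  have "0 \<le> (A *\<^sub>v ?v) \<bullet>c ?v" using A v unfolding psd_mat_def by blast
  then show ?thesis unfolding eq .
qed

lemma psd_mat_entry_le:
  assumes A: "psd_mat N A" and i: "i < N" and j: "j < N"
  shows "cmod (A $$ (i, j)) \<le> 2 * Re (mat_trace A)"
proof -
  have diag: "0 \<le> Re (A $$ (k, k))" if "k < N" for k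
    using psd_mat_two_index[OF A that that, of 1 0] by (simp add: less_eq_complex_def)
  have trace: "Re (A $$ (k, k)) \<le> Re (mat_trace A)" if "k < N" for k
  proof -
    have "dim_row A = N" using A by (auto simp: psd_mat_def)
    then show ?thesis
      unfolding mat_trace_def Re_sum using that diag by (intro member_le_sum) auto
  qed
  \<comment> \<open>The four test vectors have second coefficient \<open>1\<close>,
    \<open>-1\<close>, \<open>\<i>\<close> and \<open>-\<i>\<close>. Vanishing imaginary parts of
    the four values relate entry \<open>(j, i)\<close> to the conjugate of entry
    \<open>(i, j)\<close>; the real parts then bound twice the real and imaginary part of the entry
    by the sum of two diagonal entries, hence by twice the trace.\<close>
  have "\<bar>Re (A $$ (i, j))\<bar> \<le> Re (mat_trace A) \<and> \<bar>Im (A $$ (i, j))\<bar> \<le> Re (mat_trace A)"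
    using psd_mat_two_index[OF A i j, of 1 1] psd_mat_two_index[OF A i j, of 1 "-1"]
      psd_mat_two_index[OF A i j, of 1 \<i>] psd_mat_two_index[OF A i j, of 1 "-\<i>"]
      trace[OF i] trace[OF j]
    by (auto simp: less_eq_complex_def abs_le_iff)
  then show ?thesis
    using cmod_le[of "A $$ (i, j)"] by linarith
qed

lemma quantum_channel_carrier:
  "quantum_channel m n \<E> \<Longrightarrow> X \<in> carrier_mat m m \<Longrightarrow> \<E> X \<in> carrier_mat n n"
  by (auto simp: quantum_channel_def linear_mat_map_def)

lemma mat_trace_matrix_unit: "i < n \<Longrightarrow> mat_trace (matrix_unit n i i) = 1"
  by (simp add: mat_trace_def matrix_unit_def)

text \<open>The Choi matrix of a channel is positive semidefinite with trace 1, which bounds its entries.\<close>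

lemma quantum_channel_entry_le:
  assumes E: "quantum_channel m n \<E>" and less: "i < m" "j < m" "r < n" "s < n"
  shows "cmod (\<E> (matrix_unit m i j) $$ (r, s)) \<le> 2 * real m"
proof -
  \<comment> \<open>The Choi matrix is normalised by the unit seed: its blocks are the images of the
    matrix units divided by \<open>m\<close>. An entry bound of 2 for \<open>?C\<close> therefore
    becomes \<open>2 * m\<close> for the channel.\<close>
  let ?C = "tensor_map m m m n id \<E> (pure_density (max_entangled m))"
  have C: "?C $$ (p * n + r, q * n + s) = \<E> (matrix_unit m p q) $$ (r, s) / of_nat m"
    if "p < m" "q < m" "r < n" "s < n" for p q r s
  proof -
    have "?C $$ (p * n + r, q * n + s) = (\<Sum>u<m. \<Sum>v<m. pure_density (max_entangled m) $$ (p * m + u, q * m + v) *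
        \<E> (matrix_unit m u v) $$ (r, s))"
      by (rule tensor_map_id_index[OF quantum_channel_carrier[OF E]]) (use that in auto)
    also have "\<dots> = (\<Sum>u<m. \<Sum>v<m. if v = q then if u = p then
        \<E> (matrix_unit m u v) $$ (r, s) / of_nat m else 0 else 0)"
      by (rule sum.cong[OF refl], rule sum.cong[OF refl])
        (use that in \<open>auto simp: pure_density_max_entangled_index\<close>)
    also have "\<dots> = \<E> (matrix_unit m p q) $$ (r, s) / of_nat m"
      using that by simp
    finally show ?thesis .
  qed
  have psd: "psd_mat (m * n) ?C"
    using E pure_density_psd[OF max_entangled_carrier] by (auto simp: quantum_channel_def completely_positive_def)
  have "mat_trace ?C = (\<Sum>p<m. \<Sum>r<n. ?C $$ (p * n + r, p * n + r))"
    using carrier_matD(1)[OF tensor_map_carrier, of m m m n id \<E> "pure_density (max_entangled m)"]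
    by (simp add: mat_trace_def sum_lessThan_mult)
  also have "\<dots> = (\<Sum>p<m. mat_trace (\<E> (matrix_unit m p p)) / of_nat m)"
    by (rule sum.cong[OF refl])
      (simp add: C mat_trace_def sum_divide_distrib carrier_matD(1)[OF quantum_channel_carrier[OF E]])
  also have "\<dots> = (\<Sum>p<m. 1 / of_nat m)"
    using E by (intro sum.cong refl) (simp add: quantum_channel_def mat_trace_matrix_unit)
  also have "\<dots> = 1" using less by simp
  finally have trace: "mat_trace ?C = 1" .
  have "cmod (?C $$ (i * n + r, j * n + s)) \<le> 2 * Re (mat_trace ?C)"
    using less by (intro psd_mat_entry_le[OF psd] mult_add_less)
  then have "cmod (\<E> (matrix_unit m i j) $$ (r, s)) / real m \<le> 2"
    by (simp add: C less trace norm_divide)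
  then show ?thesis using less by (simp add: field_simps)
qed

lemma pure_fidelity_max_entangled:
  assumes \<sigma>: "\<sigma> \<in> carrier_mat (m * m) (m * m)"
  shows "pure_fidelity (max_entangled m) \<sigma> = Re (1 / of_nat m * (\<Sum>p<m. \<Sum>q<m. \<sigma> $$ (p * m + p, q * m + q)))"
proof -
  let ?s = "complex_of_real (1 / sqrt m)"
  have "(\<sigma> *\<^sub>v max_entangled m) \<bullet>c max_entangled m =
      (\<Sum>p<m. \<Sum>p'<m. \<Sum>q<m. \<Sum>q'<m. if q' = q then
        if p' = p then ?s * ?s * \<sigma> $$ (p * m + p', q * m + q') else 0 else 0)"
    unfolding quadratic_form_sum[OF \<sigma> max_entangled_carrier] sum_lessThan_mult
    by (rule sum.cong[OF refl], rule sum.cong[OF refl], rule sum.cong[OF refl], rule sum.cong[OF refl])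
      (auto simp: max_entangled_index)
  \<comment> \<open>The sum over \<open>q'\<close> collapses first and the test on \<open>p'\<close>
    moves out of the sum over \<open>q\<close>, so that the sum over \<open>p'\<close> can collapse
    next.\<close>
  also have "\<dots> = (\<Sum>p<m. \<Sum>p'<m. if p' = p then \<Sum>q<m. ?s * ?s * \<sigma> $$ (p * m + p', q * m + q) else 0)"
    by (rule sum.cong[OF refl], rule sum.cong[OF refl]) auto
  also have "\<dots> = (\<Sum>p<m. \<Sum>q<m. ?s * ?s * \<sigma> $$ (p * m + p, q * m + q))"
    by simp
  also have "\<dots> = 1 / of_nat m * (\<Sum>p<m. \<Sum>q<m. \<sigma> $$ (p * m + p, q * m + q))"
    by (simp only: inverse_sqrt_square sum_distrib_left)
  finally show ?thesis by (simp only: pure_fidelity_def)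
qed

text \<open>The seed feeds the same matrix unit to both channels and the target reads the same entry
  of both outputs. The formula serves both the boundedness proof and the exact value for the partial
  trace.\<close>

lemma pure_fidelity_tensor_map_max_entangled:
  assumes E: "quantum_channel D m \<E>" and F: "quantum_channel D m \<F>"
  shows "pure_fidelity (max_entangled m) (tensor_map D m D m \<E> \<F> (pure_density (max_entangled D))) =
    Re (1 / of_nat m * (1 / of_nat D) * (\<Sum>p<m. \<Sum>q<m. \<Sum>i<D. \<Sum>j<D.
      \<E> (matrix_unit D i j) $$ (p, q) * \<F> (matrix_unit D i j) $$ (p, q)))"
proof -
  have "tensor_map D m D m \<E> \<F> (pure_density (max_entangled D)) $$ (p * m + p, q * m + q) =
      1 / of_nat D * (\<Sum>i<D. \<Sum>j<D. \<E> (matrix_unit D i j) $$ (p, q) * \<F> (matrix_unit D i j) $$ (p, q))"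
    if "p < m" "q < m" for p q
  proof -
    let ?t = "\<lambda>i j k l. 1 / of_nat D * (\<E> (matrix_unit D i j) $$ (p, q) * \<F> (matrix_unit D k l) $$ (p, q))"
    have "tensor_map D m D m \<E> \<F> (pure_density (max_entangled D)) $$ (p * m + p, q * m + q) =
        (\<Sum>i<D. \<Sum>j<D. \<Sum>k<D. \<Sum>l<D. pure_density (max_entangled D) $$ (i * D + k, j * D + l) *
          (\<E> (matrix_unit D i j) $$ (p, q) * \<F> (matrix_unit D k l) $$ (p, q)))"
      by (rule tensor_map_index) (use that quantum_channel_carrier[OF E] quantum_channel_carrier[OF F] in auto)
    also have "\<dots> = (\<Sum>i<D. \<Sum>j<D. \<Sum>k<D. \<Sum>l<D. if l = j then if k = i then ?t i j k l else 0 else 0)"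
      by (rule sum.cong[OF refl], rule sum.cong[OF refl], rule sum.cong[OF refl], rule sum.cong[OF refl])
        (auto simp: pure_density_max_entangled_index)
    also have "\<dots> = (\<Sum>i<D. \<Sum>j<D. ?t i j i j)"
      by simp
    finally show ?thesis by (simp only: sum_distrib_left)
  qed
  then show ?thesis
    unfolding pure_fidelity_max_entangled[OF tensor_map_carrier]
    by (simp add: sum_distrib_left mult_ac)
qed

text \<open>A real supremum dominates the members of a set only if the set is bounded above. Any
  bound uniform in the channels will do, so the crude entry bound suffices.\<close>

lemma bdd_above_LO_fidelities:
  "bdd_above {pure_fidelity (max_entangled m) (tensor_map D m D m \<E> \<F> (pure_density (max_entangled D)))
       | \<E> \<F>. quantum_channel D m \<E> \<and> quantum_channel D m \<F>}"
proof (rule bdd_aboveI, clarify)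
  fix \<E> \<F> assume E: "quantum_channel D m \<E>" and F: "quantum_channel D m \<F>"
  let ?S = "\<Sum>p<m. \<Sum>q<m. \<Sum>i<D. \<Sum>j<D. \<E> (matrix_unit D i j) $$ (p, q) * \<F> (matrix_unit D i j) $$ (p, q)"
  have S: "cmod ?S \<le> (\<Sum>p<m. \<Sum>q<m. \<Sum>i<D. \<Sum>j<D. 2 * real D * (2 * real D))"
    by (intro sum_norm_le order.trans[OF norm_mult_ineq] mult_mono
        quantum_channel_entry_le[OF E] quantum_channel_entry_le[OF F]) auto
  have "Re (1 / of_nat m * (1 / of_nat D) * ?S) \<le> cmod (1 / of_nat m * (1 / of_nat D) * ?S)"
    by (rule complex_Re_le_cmod)
  also have "\<dots> = cmod (1 / of_nat m * (1 / of_nat D)) * cmod ?S"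
    by (rule norm_mult)
  also have "\<dots> \<le> cmod (1 / of_nat m * (1 / of_nat D)) * (\<Sum>p<m. \<Sum>q<m. \<Sum>i<D. \<Sum>j<D. 2 * real D * (2 * real D))"
    by (rule mult_left_mono[OF S]) simp
  finally show "pure_fidelity (max_entangled m) (tensor_map D m D m \<E> \<F> (pure_density (max_entangled D)))
      \<le> cmod (1 / of_nat m * (1 / of_nat D)) * (\<Sum>p<m. \<Sum>q<m. \<Sum>i<D. \<Sum>j<D. 2 * real D * (2 * real D))"
    unfolding pure_fidelity_tensor_map_max_entangled[OF E F] .
qed

section \<open>The partial trace over the second tensor factor as a quantum channel\<close>

definition partial_trace :: "nat \<Rightarrow> nat \<Rightarrow> complex mat \<Rightarrow> complex mat" where
  "partial_trace m n X = mat m m (\<lambda>(i, j). \<Sum>a<n. X $$ (i * n + a, j * n + a))"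

lemma mult_add_eq_iff: "a < n \<Longrightarrow> b < n \<Longrightarrow> i * n + a = j * n + b \<longleftrightarrow> i = j \<and> a = (b::nat)"
  by (metis add_right_cancel div_mult_self3 less_nat_zero_code mod_less mod_mult_self3)

lemma partial_trace_matrix_unit:
  assumes "i < m" "j < m" "a < n" "b < n" "p < m" "q < m"
  shows "partial_trace m n (matrix_unit (m * n) (i * n + a) (j * n + b)) $$ (p, q) =
    (if b = a then if j = q then if i = p then 1 else 0 else 0 else 0)"
proof -
  have "partial_trace m n (matrix_unit (m * n) (i * n + a) (j * n + b)) $$ (p, q) =
      (\<Sum>c<n. matrix_unit (m * n) (i * n + a) (j * n + b) $$ (p * n + c, q * n + c))"
    using assms by (simp add: partial_trace_def)
  also have "\<dots> = (\<Sum>c<n. if c = a then if b = a then if j = q then if i = p then 1 else 0 else 0 else 0 else 0)"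
    by (rule sum.cong[OF refl]) (use assms in \<open>auto simp: mult_add_less mult_add_eq_iff\<close>)
  finally show ?thesis using assms by simp
qed

text \<open>Tensor factors reassociate: \<open>p * (m * n) + (r * n + a)\<close> equals
  \<open>(p * m + r) * n + a\<close>, so extending by an identity on dimension \<open>k\<close>
  yields the partial trace with \<open>k * m\<close> in place of \<open>m\<close>.\<close>

lemma tensor_map_id_partial_trace:
  assumes "R < k * m" "S < k * m"
  shows "tensor_map k k (m * n) m id (partial_trace m n) X $$ (R, S) = (\<Sum>a<n. X $$ (R * n + a, S * n + a))"
proof -
  define p r q s where "p = R div m" "r = R mod m" "q = S div m" "s = S mod m"
  have "m > 0" using assms by (cases m) auto
  then have less: "p < k" "q < k" "r < m" "s < m"
    using assms by (auto simp: p_r_q_s_def less_mult_imp_div_less)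
  have RS: "R = p * m + r" "S = q * m + s" by (auto simp: p_r_q_s_def)
  have "tensor_map k k (m * n) m id (partial_trace m n) X $$ (R, S) =
     (\<Sum>u<m. \<Sum>a<n. \<Sum>v<m. \<Sum>b<n. X $$ (p * (m * n) + (u * n + a), q * (m * n) + (v * n + b)) *
       partial_trace m n (matrix_unit (m * n) (u * n + a) (v * n + b)) $$ (r, s))"
    unfolding RS by (subst tensor_map_id_index[OF _ less]) (auto simp: partial_trace_def sum_lessThan_mult)
  also have "\<dots> = (\<Sum>u<m. \<Sum>a<n. \<Sum>v<m. \<Sum>b<n. if b = a then if v = s then if u = r then
       X $$ (p * (m * n) + (u * n + a), q * (m * n) + (v * n + b)) else 0 else 0 else 0)"
    by (rule sum.cong[OF refl], rule sum.cong[OF refl], rule sum.cong[OF refl], rule sum.cong[OF refl])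
      (use less in \<open>simp add: partial_trace_matrix_unit\<close>)
  also have "\<dots> = (\<Sum>u<m. \<Sum>a<n. if u = r then
       X $$ (p * (m * n) + (u * n + a), q * (m * n) + (s * n + a)) else 0)"
    using less by simp
  also have "\<dots> = (\<Sum>a<n. X $$ (p * (m * n) + (r * n + a), q * (m * n) + (s * n + a)))"
    using less by (subst sum.swap) simp
  also have "\<dots> = (\<Sum>a<n. X $$ (R * n + a, S * n + a))"
    by (simp add: RS algebra_simps)
  finally show ?thesis .
qed

text \<open>The quadratic form of the extended partial trace at \<open>v\<close> is the sum over
  \<open>a\<close> of the quadratic forms of \<open>X\<close> at \<open>v\<close> tensored with
  basis vector \<open>a\<close>, and each summand is nonnegative.\<close>

lemma completely_positive_partial_trace: "completely_positive (m * n) m (partial_trace m n)"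
  unfolding completely_positive_def
proof (intro allI impI)
  fix k X assume X: "psd_mat (k * (m * n)) X"
  let ?T = "tensor_map k k (m * n) m id (partial_trace m n) X"
  show "psd_mat (k * m) ?T"
    unfolding psd_mat_def
  proof (intro conjI ballI)
    show T: "?T \<in> carrier_mat (k * m) (k * m)" by (rule tensor_map_carrier)
    fix v :: "complex vec" assume v: "v \<in> carrier_vec (k * m)"
    \<comment> \<open>\<open>w a\<close> is the tensor product of \<open>v\<close> with basis vector
      \<open>a\<close> of the discarded factor.\<close>
    define w where "w a = vec (k * (m * n)) (\<lambda>t. if t mod n = a then v $ (t div n) else 0)" for a
    have w: "w a $ (R * n + b) = (if b = a then v $ R else 0)" if "R < k * m" "b < n" for R a b
      using mult_add_less[OF that] that by (simp add: w_def mult.assoc)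
    have cX: "X \<in> carrier_mat (k * m * n) (k * m * n)"
      and cw: "w a \<in> carrier_vec (k * m * n)" for a
      using X by (auto simp: psd_mat_def w_def mult.assoc)
    have quad: "(X *\<^sub>v w a) \<bullet>c w a =
        (\<Sum>R<k * m. \<Sum>S<k * m. X $$ (R * n + a, S * n + a) * v $ S * cnj (v $ R))" if "a < n" for a
    proof -
      have "(X *\<^sub>v w a) \<bullet>c w a = (\<Sum>R<k * m. \<Sum>b<n. \<Sum>S<k * m. \<Sum>c<n. if c = a then if b = a then
          X $$ (R * n + b, S * n + c) * v $ S * cnj (v $ R) else 0 else 0)"
        unfolding quadratic_form_sum[OF cX cw] sum_lessThan_mult[of _ "k * m" n]
        by (rule sum.cong[OF refl], rule sum.cong[OF refl], rule sum.cong[OF refl], rule sum.cong[OF refl])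
          (auto simp: w)
      also have "\<dots> = (\<Sum>R<k * m. \<Sum>b<n. if b = a then
          \<Sum>S<k * m. X $$ (R * n + b, S * n + a) * v $ S * cnj (v $ R) else 0)"
        by (rule sum.cong[OF refl], rule sum.cong[OF refl]) (use that in auto)
      also have "\<dots> = (\<Sum>R<k * m. \<Sum>S<k * m. X $$ (R * n + a, S * n + a) * v $ S * cnj (v $ R))"
        using that by simp
      finally show ?thesis .
    qed
    have "(?T *\<^sub>v v) \<bullet>c v = (\<Sum>R<k * m. \<Sum>S<k * m. \<Sum>a<n. X $$ (R * n + a, S * n + a) * v $ S * cnj (v $ R))"
      unfolding quadratic_form_sum[OF T v]
      by (rule sum.cong[OF refl], rule sum.cong[OF refl])
        (simp add: tensor_map_id_partial_trace sum_distrib_right)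
    also have "\<dots> = (\<Sum>R<k * m. \<Sum>a<n. \<Sum>S<k * m. X $$ (R * n + a, S * n + a) * v $ S * cnj (v $ R))"
      by (rule sum.cong[OF refl], rule sum.swap)
    also have "\<dots> = (\<Sum>a<n. \<Sum>R<k * m. \<Sum>S<k * m. X $$ (R * n + a, S * n + a) * v $ S * cnj (v $ R))"
      by (rule sum.swap)
    also have "\<dots> = (\<Sum>a<n. (X *\<^sub>v w a) \<bullet>c w a)"
      by (rule sum.cong[OF refl]) (simp add: quad)
    also have "0 \<le> \<dots>"
      using X cw by (intro sum_nonneg) (auto simp: psd_mat_def mult.assoc)
    finally show "0 \<le> (?T *\<^sub>v v) \<bullet>c v" .
  qed
qed

lemma quantum_channel_partial_trace: "quantum_channel (m * n) m (partial_trace m n)"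
  unfolding quantum_channel_def
proof (intro conjI completely_positive_partial_trace ballI)
  show "linear_mat_map (m * n) m (partial_trace m n)"
    unfolding linear_mat_map_def
  proof (intro conjI ballI allI)
    fix X Y :: "complex mat" and c
    assume X: "X \<in> carrier_mat (m * n) (m * n)"
    show "partial_trace m n X \<in> carrier_mat m m"
      by (simp add: partial_trace_def)
    show "partial_trace m n (c \<cdot>\<^sub>m X) = c \<cdot>\<^sub>m partial_trace m n X"
      using X by (intro eq_matI) (auto simp: partial_trace_def mult_add_less sum_distrib_left)
    assume Y: "Y \<in> carrier_mat (m * n) (m * n)"
    show "partial_trace m n (X + Y) = partial_trace m n X + partial_trace m n Y"
      using X Y by (intro eq_matI) (auto simp: partial_trace_def mult_add_less sum.distrib)
  qed
  fix X :: "complex mat" assume "X \<in> carrier_mat (m * n) (m * n)"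
  then show "mat_trace (partial_trace m n X) = mat_trace X"
    by (simp add: mat_trace_def partial_trace_def sum_lessThan_mult)
qed

lemma F_LO_max_entangled_ge:
  assumes "m > 0" "n > 0"
  shows "F_LO m m (max_entangled m) (m * n) (m * n) (max_entangled (m * n)) \<ge> 1"
proof -
  let ?T = "partial_trace m n"
  have T: "quantum_channel (m * n) m ?T" by (rule quantum_channel_partial_trace)
  \<comment> \<open>A pair \<open>i\<close>, \<open>j\<close> contributes 1 exactly when its outer
    parts are \<open>p\<close> and \<open>q\<close> and its inner parts agree, which happens
    \<open>n\<close> times. Summed over \<open>p\<close> and \<open>q\<close> this is
    \<open>m * m * n\<close>, which cancels the prefactor \<open>1 / (m * (m * n))\<close>.\<close>
  have "(\<Sum>i<m * n. \<Sum>j<m * n. ?T (matrix_unit (m * n) i j) $$ (p, q) * ?T (matrix_unit (m * n) i j) $$ (p, q))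
      = of_nat n" if "p < m" "q < m" for p q
  proof -
    have "(\<Sum>i<m * n. \<Sum>j<m * n. ?T (matrix_unit (m * n) i j) $$ (p, q) * ?T (matrix_unit (m * n) i j) $$ (p, q))
      = (\<Sum>i<m. \<Sum>a<n. \<Sum>j<m. \<Sum>b<n. if b = a then if j = q then if i = p then 1 else 0 else 0 else 0)"
      unfolding sum_lessThan_mult
      by (rule sum.cong[OF refl], rule sum.cong[OF refl], rule sum.cong[OF refl], rule sum.cong[OF refl])
        (use that in \<open>simp add: partial_trace_matrix_unit\<close>)
    also have "\<dots> = (\<Sum>i<m. \<Sum>a<n. if i = p then 1 else 0)"
      using that by simp
    also have "\<dots> = of_nat n"
      using that by (subst sum.swap) simp
    finally show ?thesis .
  qed
  then have "pure_fidelity (max_entangled m)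
      (tensor_map (m * n) m (m * n) m ?T ?T (pure_density (max_entangled (m * n)))) = 1"
    unfolding pure_fidelity_tensor_map_max_entangled[OF T T] using assms by simp
  then have "1 \<in> {pure_fidelity (max_entangled m)
      (tensor_map (m * n) m (m * n) m \<E> \<F> (pure_density (max_entangled (m * n))))
       | \<E> \<F>. quantum_channel (m * n) m \<E> \<and> quantum_channel (m * n) m \<F>}"
    using T by (auto intro!: exI[of _ ?T])
  then show ?thesis
    unfolding F_LO_def by (rule cSup_upper[OF _ bdd_above_LO_fidelities])
qed

theorem theorem5:
  shows "\<exists>tA tB \<psi> sA sB \<phi>.
    bipartite_state tA tB \<psi> \<and> bipartite_state sA sB \<phi> \<and>
    schmidt_rank tA tB \<psi> \<ge> 3 \<and> schmidt_rank sA sB \<phi> \<ge> 3 \<and>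
    F_LO tA tB \<psi> sA sB \<phi> > F_LU tA tB \<psi> sA sB \<phi>"
proof (intro exI conjI)
  \<comment> \<open>\<open>m = 3\<close> is the least target rank allowed and \<open>n = 2\<close>
    the least nontrivial discarded factor, so the seed has local dimension 6. Local unitaries then
    reach at most 1/2, local operations at least 1.\<close>
  show "bipartite_state 3 3 (max_entangled 3)" and "bipartite_state 6 6 (max_entangled 6)"
    by (simp_all add: bipartite_state_max_entangled)
  show "schmidt_rank 3 3 (max_entangled 3) \<ge> 3" and "schmidt_rank 6 6 (max_entangled 6) \<ge> 3"
    by (simp_all add: schmidt_rank_max_entangled)
  show "F_LO 3 3 (max_entangled 3) 6 6 (max_entangled 6) > F_LU 3 3 (max_entangled 3) 6 6 (max_entangled 6)"
    using F_LU_max_entangled_le[of 3 6] F_LO_max_entangled_ge[of 3 2] by simp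
qed

end
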